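(* Let $n\ge 2$, let $K\subset\mathbb{R}^n$ be an $o$-symmetric convex body with non-empty interior, let $\Lambda\subset\mathbb{R}^n$ be a lattice of rank $n$, and let $s\ge 1$ and $\Lambda_1,\dots,\Lambda_s\subset\Lambda$ be sublattices with $1\le\operatorname{rank}\Lambda_i\le n-1$ for $1\le i\le s$. Then for every $j=1,\dots,n-1$, $$\lambda_{j+1}\Bigl(K,\Lambda\setminus\bigcup_{i=1}^s\Lambda_i\Bigr)<6^{n-1}\frac{\det\Lambda}{\lambda_1(K,\Lambda)^{n-2}\operatorname{vol}(K)}\left(\sum_{i=1}^s\frac{1}{\lambda_1(K,\Lambda_i)}\right)+\left(\frac{3^j}{\lambda_1(K,\Lambda)^j}\,2^{n-1}\frac{\det\Lambda}{\operatorname{vol}(K)}+\left(2^n\frac{\det\Lambda}{\operatorname{vol}(K)}\right)^{\frac{n-j}{n}}\right)^{\frac{1}{n-j}}.$$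
   Context: An $o$-symmetric convex body is a compact convex set $K\subset\mathbb{R}^n$ with $K=-K$; $\operatorname{vol}$ is $n$-dimensional Lebesgue measure. A lattice $\Lambda\subset\mathbb{R}^n$ is a discrete additive subgroup (the $\mathbb{Z}$-span of $r$ linearly independent vectors, $r=\operatorname{rank}\Lambda\le n$); $\det\Lambda$ is the $r$-dimensional volume of a fundamental cell of $\Lambda$. For a set $X\subset\mathbb{R}^n$, $\dim X$ denotes here the dimension of its linear span (the maximal number of linearly independent points of $X$). The successive minima are $\lambda_i(K,\Lambda)=\min\{\lambda\ge 0:\dim(\lambda K\cap\Lambda)\ge i\}$ for $1\le i\le\operatorname{rank}\Lambda$. For sublattices $\Lambda_1,\dots,\Lambda_s\subset\Lambda$ with $\bigcup_{i=1}^s\Lambda_i\neq\Lambda$ the $j$-th restricted successive minimum is $\lambda_j(K,\Lambda\setminus\bigcup_{i=1}^s\Lambda_i)=\min\{\lambda\ge 0:\dim(\lambda K\cap(\Lambda\setminus\bigcup_{i=1}^s\Lambda_i))\ge j\}$ for $1\le j\le\operatorname{rank}\Lambda$. (For sublattices of rank less than $\operatorname{rank}\Lambda$, the condition $\bigcup_i\Lambda_i\ne\Lambda$ holds automatically.) *)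

theory Defs
  imports "HOL-Analysis.Analysis"
begin

definition o_symmetric_convex_body :: "'a::euclidean_space set \<Rightarrow> bool" where
  "o_symmetric_convex_body K \<longleftrightarrow> compact K \<and> convex K \<and> uminus ` K = K"

definition is_lattice :: "'a::euclidean_space set \<Rightarrow> bool" where
  "is_lattice L \<longleftrightarrow> 0 \<in> L \<and> (\<forall>x\<in>L. \<forall>y\<in>L. x - y \<in> L) \<and> discrete L"

definition int_span :: "'a::real_vector set \<Rightarrow> 'a set" where
  "int_span B = range (\<lambda>z :: 'a \<Rightarrow> int. \<Sum>b\<in>B. of_int (z b) *\<^sub>R b)"

definition is_lattice_basis :: "'a::euclidean_space set \<Rightarrow> 'a set \<Rightarrow> bool" where
  "is_lattice_basis L B \<longleftrightarrow> independent B \<and> int_span B = L"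

definition lattice_basis :: "'a::euclidean_space set \<Rightarrow> 'a set" where
  "lattice_basis L = (SOME B. is_lattice_basis L B)"

definition lattice_rank :: "'a::euclidean_space set \<Rightarrow> nat" where
  "lattice_rank L = card (lattice_basis L)"

definition fundamental_cell :: "'a::real_vector set \<Rightarrow> 'a set" where
  "fundamental_cell B = {\<Sum>b\<in>B. t b *\<^sub>R b | t. \<forall>b\<in>B. 0 \<le> t b \<and> t b < (1::real)}"

text \<open>
  The measure of the fundamental cell is taken in the ambient space, so this is the
  determinant only for lattices of full rank; for these the value does not depend on the
  chosen basis.
\<close>
definition lattice_det :: "'a::euclidean_space set \<Rightarrow> real" where
  "lattice_det L = measure lebesgue (fundamental_cell (lattice_basis L))"

text \<open>
  The set \<open>X\<close> is either a lattice, which gives the successive minima, or a lattice without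
  a union of sublattices, which gives the restricted successive minima.
  The constant \<^const>\<open>dim\<close> is the dimension of the linear span.
  As \<^const>\<open>Least\<close> on the reals, the value is meaningful only if the minimum is attained.
\<close>
definition succ_min :: "'a::euclidean_space set \<Rightarrow> 'a set \<Rightarrow> nat \<Rightarrow> real" where
  "succ_min K X j = (LEAST l. 0 \<le> l \<and> j \<le> dim ((*\<^sub>R) l ` K \<inter> X))"

text \<open>Every lattice has a basis, so \<^const>\<open>lattice_basis\<close> is well defined.\<close>

lemma is_lattice_0: "is_lattice L \<Longrightarrow> 0 \<in> L"
  and is_lattice_diff: "is_lattice L \<Longrightarrow> x \<in> L \<Longrightarrow> y \<in> L \<Longrightarrow> x - y \<in> L"
  by (auto simp: is_lattice_def)

lemma is_lattice_uminus: "is_lattice L \<Longrightarrow> x \<in> L \<Longrightarrow> - x \<in> L"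
  using is_lattice_diff[of L 0 x] is_lattice_0[of L] by simp

lemma is_lattice_add: "is_lattice L \<Longrightarrow> x \<in> L \<Longrightarrow> y \<in> L \<Longrightarrow> x + y \<in> L"
  using is_lattice_diff[of L x "- y"] is_lattice_uminus[of L y] by simp

lemma is_lattice_scale_int:
  assumes "is_lattice L" "x \<in> L"
  shows "of_int m *\<^sub>R x \<in> L"
proof (induction m rule: int_induct[where k = 0])
  case base
  then show ?case using assms by (simp add: is_lattice_0)
next
  case (step1 i)
  then show ?case using assms by (simp add: scaleR_add_left is_lattice_add)
next
  case (step2 i)
  then show ?case using assms by (simp add: scaleR_diff_left is_lattice_diff)
qed

lemma is_lattice_sum:
  assumes "is_lattice L" "\<And>b. b \<in> B \<Longrightarrow> f b \<in> L"
  shows "sum f B \<in> L"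
  using assms(2) by (induction B rule: infinite_finite_induct)
    (auto simp: is_lattice_0[OF assms(1)] is_lattice_add[OF assms(1)])

lemma int_span_subset:
  assumes "is_lattice L" "B \<subseteq> L"
  shows "int_span B \<subseteq> L"
  unfolding int_span_def using assms by (auto intro!: is_lattice_sum is_lattice_scale_int)

lemma finite_lattice_Int_bounded:
  assumes L: "is_lattice L" and "bounded S"
  shows "finite (L \<inter> S)"
proof -
  obtain e where e: "e > 0" "\<And>y. y \<in> L \<Longrightarrow> norm y < e \<Longrightarrow> y = 0"
    using L dist_0_norm unfolding is_lattice_def discrete_def isolated_in_dist_Ex_iff by metis
  have "uniform_discrete L"
    unfolding uniform_discrete_def
  proof (intro exI[of _ e] conjI ballI impI e)
    fix x y assume "x \<in> L" "y \<in> L" "dist x y < e"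
    then show "x = y"
      using e(2)[of "x - y"] is_lattice_diff[OF L] by (auto simp: dist_norm)
  qed
  then have "uniform_discrete (L \<inter> S)" by (rule uniform_discrete_subset) auto
  moreover have "bounded (L \<inter> S)" using assms(2) by (rule bounded_subset) auto
  ultimately show ?thesis using uniform_discrete_finite_iff by blast
qed

lemma lattice_basis_extend:
  fixes L :: "'a::euclidean_space set"
  assumes L: "is_lattice L"
    and D: "finite D" "independent D" "D \<subseteq> L" "L \<inter> span D \<subseteq> int_span D"
    and c: "c \<in> L" "c \<notin> span D"
  obtains v where "v \<in> L" "v \<notin> span D" "span (insert v D) = span (insert c D)"
    "L \<inter> span (insert v D) \<subseteq> int_span (insert v D)"
proof -
  define M where "M = norm c + (\<Sum>b\<in>D. norm b)"
  define T where "T = {t. 0 < t \<and> t \<le> 1 \<and> (\<exists>x\<in>L. x - t *\<^sub>R c \<in> span D)}"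
  have uniq: "s = t" if "x - s *\<^sub>R c \<in> span D" "x - t *\<^sub>R c \<in> span D" for x s t
  proof (rule ccontr)
    assume "s \<noteq> t"
    have "(t - s) *\<^sub>R c \<in> span D"
      using span_diff[OF that] by (simp add: algebra_simps)
    then have "(1 / (t - s)) *\<^sub>R ((t - s) *\<^sub>R c) \<in> span D" by (rule span_scale)
    then show False using c(2) \<open>s \<noteq> t\<close> by simp
  qed
  have "T \<subseteq> (\<lambda>x. THE t. x - t *\<^sub>R c \<in> span D) ` (L \<inter> cball 0 M)"
  proof
    fix t assume "t \<in> T"
    then obtain x where t: "0 < t" "t \<le> 1" and x: "x \<in> L" "x - t *\<^sub>R c \<in> span D"
      unfolding T_def by auto
    obtain u where u: "x - t *\<^sub>R c = (\<Sum>b\<in>D. u b *\<^sub>R b)"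
      using x(2) unfolding span_finite[OF D(1)] by auto
    define y where "y = x - (\<Sum>b\<in>D. of_int \<lfloor>u b\<rfloor> *\<^sub>R b)"
    have yL: "y \<in> L"
      unfolding y_def using D(3)
      by (intro is_lattice_diff[OF L] x is_lattice_sum[OF L] is_lattice_scale_int[OF L]) auto
    have "y - t *\<^sub>R c = (x - t *\<^sub>R c) - (\<Sum>b\<in>D. of_int \<lfloor>u b\<rfloor> *\<^sub>R b)"
      unfolding y_def by simp
    also have "\<dots> = (\<Sum>b\<in>D. frac (u b) *\<^sub>R b)"
      unfolding u by (simp add: frac_def scaleR_diff_left sum_subtractf)
    finally have y: "y - t *\<^sub>R c = (\<Sum>b\<in>D. frac (u b) *\<^sub>R b)" .
    have sp: "y - t *\<^sub>R c \<in> span D"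
      unfolding y by (intro span_sum span_scale span_base)
    have "norm (\<Sum>b\<in>D. frac (u b) *\<^sub>R b) \<le> (\<Sum>b\<in>D. norm b)"
    proof (rule sum_norm_le)
      fix b
      have "\<bar>frac (u b)\<bar> \<le> 1" using frac_ge_0[of "u b"] frac_lt_1[of "u b"] by linarith
      then show "norm (frac (u b) *\<^sub>R b) \<le> norm b"
        by (simp add: mult_left_le_one_le)
    qed
    moreover have "norm (t *\<^sub>R c) \<le> norm c" using t by (simp add: mult_left_le_one_le)
    moreover have "y = t *\<^sub>R c + (\<Sum>b\<in>D. frac (u b) *\<^sub>R b)" using y by (simp add: algebra_simps)
    ultimately have "norm y \<le> M"
      unfolding M_def using norm_triangle_ineq[of "t *\<^sub>R c" "\<Sum>b\<in>D. frac (u b) *\<^sub>R b"] by simp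
    moreover have "(THE t. y - t *\<^sub>R c \<in> span D) = t"
      using sp uniq by (intro the_equality) auto
    ultimately show "t \<in> (\<lambda>x. THE t. x - t *\<^sub>R c \<in> span D) ` (L \<inter> cball 0 M)"
      using yL by (intro image_eqI[of _ _ y]) auto
  qed
  then have finT: "finite T"
    using finite_lattice_Int_bounded[OF L bounded_cball] by (meson finite_imageI finite_subset)
  have "1 \<in> T" unfolding T_def using c(1) by (auto intro!: bexI[of _ c] span_zero)
  define t0 where "t0 = Min T"
  have "t0 \<in> T" unfolding t0_def using finT \<open>1 \<in> T\<close> by (intro Min_in) auto
  then obtain v where t0: "0 < t0" "t0 \<le> 1" and v: "v \<in> L" "v - t0 *\<^sub>R c \<in> span D"
    unfolding T_def by auto
  have t0_le: "t0 \<le> t" if "t \<in> T" for t unfolding t0_def using finT that by simp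
  have vD: "v \<notin> span D"
    using uniq[of v 0 t0] v(2) t0 by auto
  have mono: "span D \<subseteq> span (insert w D)" for w by (rule span_mono) auto
  have "v \<in> span (insert c D)" using v(2) by (auto simp: span_breakdown_eq)
  moreover have "c \<in> span (insert v D)"
  proof -
    have "v - (v - t0 *\<^sub>R c) \<in> span (insert v D)"
      using mono[of v] v(2) by (blast intro: span_diff span_base)
    then have "(1 / t0) *\<^sub>R (v - (v - t0 *\<^sub>R c)) \<in> span (insert v D)" by (rule span_scale)
    then show ?thesis using t0 by simp
  qed
  ultimately have eq: "span (insert v D) = span (insert c D)"
    unfolding span_eq by (auto intro: span_base)
  have "L \<inter> span (insert v D) \<subseteq> int_span (insert v D)"
  proof
    fix x assume "x \<in> L \<inter> span (insert v D)"
    then have x: "x \<in> L" "x \<in> span (insert c D)" using eq by auto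
    obtain k where k: "x - k *\<^sub>R c \<in> span D" using x(2) by (auto simp: span_breakdown_eq)
    define m where "m = \<lfloor>k / t0\<rfloor>"
    define r where "r = k - of_int m * t0"
    define y where "y = x - of_int m *\<^sub>R v"
    have "of_int m \<le> k / t0" "k / t0 < of_int m + 1" unfolding m_def by linarith+
    then have r: "0 \<le> r" "r < t0" unfolding r_def using t0 by (auto simp: field_simps)
    have yL: "y \<in> L"
      unfolding y_def by (intro is_lattice_diff[OF L] x is_lattice_scale_int[OF L] v)
    have "y - r *\<^sub>R c = (x - k *\<^sub>R c) - of_int m *\<^sub>R (v - t0 *\<^sub>R c)"
      unfolding y_def r_def by (simp add: algebra_simps)
    then have yD: "y - r *\<^sub>R c \<in> span D" using k v(2) by (metis span_diff span_scale)
    have "r = 0"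
    proof (rule ccontr)
      assume "r \<noteq> 0"
      then have "r \<in> T" unfolding T_def using r t0 yL yD by auto
      then show False using t0_le r by force
    qed
    then obtain z :: "'a \<Rightarrow> int" where z: "y = (\<Sum>b\<in>D. of_int (z b) *\<^sub>R b)"
      using yD yL D(4) unfolding int_span_def by auto
    have vnD: "v \<notin> D" using vD span_base by auto
    have "x = of_int m *\<^sub>R v + y" unfolding y_def by simp
    also have "\<dots> = (\<Sum>b\<in>insert v D. of_int ((z(v := m)) b) *\<^sub>R b)"
      unfolding z using vnD D(1) by (auto intro!: sum.cong)
    finally show "x \<in> int_span (insert v D)" unfolding int_span_def by blast
  qed
  then show ?thesis using that v(1) vD eq by blast
qed

lemma lattice_basis_exists:
  fixes L :: "'a::euclidean_space set"
  assumes L: "is_lattice L"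
  shows "\<exists>B. is_lattice_basis L B"
proof -
  have step: "\<exists>D. finite D \<and> independent D \<and> D \<subseteq> L \<and> span D = span C \<and> L \<inter> span D \<subseteq> int_span D"
    if "finite C" "independent C" "C \<subseteq> L" for C
    using that
  proof (induction C rule: finite_induct)
    case empty
    then show ?case
      by (intro exI[of _ "{}"]) (auto simp: int_span_def independent_empty)
  next
    case (insert c C)
    then obtain D where D: "finite D" "independent D" "D \<subseteq> L" "span D = span C"
      "L \<inter> span D \<subseteq> int_span D"
      by (auto simp: independent_insert)
    have c: "c \<in> L" "c \<notin> span D" using insert D by (auto simp: independent_insert)
    obtain v where v: "v \<in> L" "v \<notin> span D" "span (insert v D) = span (insert c D)"
      "L \<inter> span (insert v D) \<subseteq> int_span (insert v D)"
      using lattice_basis_extend[OF L D(1,2,3,5) c] by blast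
    have "span (insert c D) = span (insert c C)"
      using D(4) by (simp add: span_insert)
    then show ?case
      using v D independent_insertI[OF v(2) D(2)] by (intro exI[of _ "insert v D"]) auto
  qed
  obtain C where C: "C \<subseteq> L" "independent C" "L \<subseteq> span C"
    by (rule maximal_independent_subset)
  then obtain D where D: "independent D" "D \<subseteq> L" "span D = span C" "L \<inter> span D \<subseteq> int_span D"
    using step[OF independent_imp_finite] by blast
  then have "int_span D = L" using C int_span_subset[OF L D(2)] by blast
  then show ?thesis using D(1) unfolding is_lattice_basis_def by blast
qed

lemma is_lattice_basis_lattice_basis:
  "is_lattice L \<Longrightarrow> is_lattice_basis L (lattice_basis L)"
  unfolding lattice_basis_def by (rule someI_ex[OF lattice_basis_exists])

lemma lattice_rank_eq_dim:
  assumes "is_lattice L"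
  shows "lattice_rank L = dim L"
proof -
  let ?B = "lattice_basis L"
  have B: "independent ?B" "int_span ?B = L"
    using is_lattice_basis_lattice_basis[OF assms] unfolding is_lattice_basis_def by auto
  have "finite ?B" using B(1) by (rule independent_imp_finite)
  have "?B \<subseteq> int_span ?B"
  proof
    fix b assume "b \<in> ?B"
    then have "b = (\<Sum>a\<in>?B. of_int (if a = b then 1 else 0) *\<^sub>R a)"
      using \<open>finite ?B\<close> by (simp add: if_distrib[of "\<lambda>x. of_int x *\<^sub>R _"] cong: if_cong)
    then show "b \<in> int_span ?B"
      unfolding int_span_def by (intro range_eqI[of _ _ "\<lambda>a. if a = b then 1 else 0"])
  qed
  moreover have "int_span ?B \<subseteq> span ?B"
    unfolding int_span_def by (auto intro: span_sum span_scale span_base)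
  ultimately show ?thesis
    unfolding lattice_rank_def using B basis_card_eq_dim by metis
qed

end

theory Submission
  imports Defs
begin

text \<open>
  Let \<open>\<rho>\<close> be the right-hand side and suppose that the points of \<open>L\<close> outside all \<open>Ls i\<close> whose
  Minkowski functional is less than \<open>\<rho>\<close> span at most a \<open>j\<close>-dimensional space \<open>S\<close>. Then every
  lattice point below \<open>\<rho>\<close> lies in some \<open>Ls i\<close> or in \<open>L \<inter> S\<close>. A lattice \<open>M\<close> of rank \<open>r\<close> whose
  non-zero points all have functional at least \<open>\<mu>\<close> contains fewer than \<open>(3 \<rho> / \<mu>)^r\<close> non-zero
  points below \<open>\<rho>\<close>, as such points are pairwise incongruent modulo \<open>m M\<close> for \<open>m \<ge> 2 \<rho> / \<mu>\<close>.
  On the other hand, van der Corput's theorem gives at least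
  \<open>2 \<rho>^n vol K / (2^n det L) - 2\<close> non-zero points of \<open>L\<close> below \<open>\<rho>\<close>. Together,
  \<open>\<rho>^n < A \<rho>^(n-1) + B \<rho>^j + C\<close>, where \<open>\<rho> = A + (B + C^((n-j)/n))^(1/(n-j))\<close>, and this is
  impossible.
\<close>

section \<open>Symmetric convex bodies and their Minkowski functional\<close>

text \<open>By symmetry \<open>K\<close> contains the reflection of a ball around \<open>a\<close>,
  and the midpoint of \<open>a + y\<close> and \<open>-(a - y)\<close> is \<open>y\<close>; so a
  ball anywhere in \<open>K\<close> can be moved to the origin.\<close>

lemma symmetric_body_ball:
  assumes K: "o_symmetric_convex_body K" "interior K \<noteq> {}"
  obtains e where "0 < e" "ball 0 e \<subseteq> K"
proof -
  have cvx: "convex K" and sym: "\<And>x. x \<in> K \<Longrightarrow> - x \<in> K"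
    using K unfolding o_symmetric_convex_body_def by auto
  obtain a e where e: "0 < e" "ball a e \<subseteq> K"
    using K(2) mem_interior by blast
  have "ball 0 e \<subseteq> K"
  proof
    fix y :: 'a assume "y \<in> ball 0 e"
    then have "a + y \<in> K" "a - y \<in> K"
      using e(2) by (auto simp: dist_norm subset_iff)
    then have "(1/2) *\<^sub>R (a + y) + (1/2) *\<^sub>R (- (a - y)) \<in> K"
      by (intro convexD[OF cvx] sym) auto
    moreover have "(1/2) *\<^sub>R (a + y) + (1/2) *\<^sub>R (- (a - y)) = y"
      by (simp add: algebra_simps flip: scaleR_add_left)
    ultimately show "y \<in> K" by metis
  qed
  then show ?thesis using e(1) that by blast
qed

definition minkowski_functional :: "'a::real_vector set \<Rightarrow> 'a \<Rightarrow> real" where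
  "minkowski_functional K x = Inf {l. 0 \<le> l \<and> x \<in> (*\<^sub>R) l ` K}"

locale symmetric_body =
  fixes K :: "'a::euclidean_space set"
  assumes body: "o_symmetric_convex_body K" and nonempty_interior: "interior K \<noteq> {}"
begin

abbreviation g where "g \<equiv> minkowski_functional K"

lemma compact_K: "compact K" and convex_K: "convex K" and uminus_K: "x \<in> K \<Longrightarrow> - x \<in> K"
  using body unfolding o_symmetric_convex_body_def by auto

lemma zero_mem_K: "0 \<in> K"
  using symmetric_body_ball[OF body nonempty_interior] by (metis centre_in_ball subsetD)

lemma mem_scale_iff_scaled: "0 < l \<Longrightarrow> x \<in> (*\<^sub>R) l ` K \<longleftrightarrow> (1 / l) *\<^sub>R x \<in> K"
  by (auto simp: image_iff intro: bexI[of _ "(1 / l) *\<^sub>R x"])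

lemma absorbing: "\<exists>l>0. x \<in> (*\<^sub>R) l ` K"
proof -
  obtain e where e: "0 < e" "ball 0 e \<subseteq> K"
    using symmetric_body_ball[OF body nonempty_interior] by blast
  \<comment> \<open>The \<open>+ 1\<close> keeps \<open>l\<close> positive at \<open>x = 0\<close>
    and puts the scaled point strictly inside the ball.\<close>
  define l where "l = (norm x + 1) / e"
  have l: "0 < l" unfolding l_def using e by (auto intro!: divide_pos_pos add_nonneg_pos)
  have p: "0 < norm x + 1" using norm_ge_zero[of x] by linarith
  have "norm ((1 / l) *\<^sub>R x) = norm x * e / (norm x + 1)" unfolding l_def using e p by (simp add: field_simps)
  also have "\<dots> < e" using e p by (simp add: pos_divide_less_eq)
  finally have "norm ((1 / l) *\<^sub>R x) < e" .
  then have "(1 / l) *\<^sub>R x \<in> K" using e(2) by auto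
  then show ?thesis using l mem_scale_iff_scaled by blast
qed

lemma scale_mono:
  assumes "0 \<le> l" "l \<le> m" shows "(*\<^sub>R) l ` K \<subseteq> (*\<^sub>R) m ` K"
proof (cases "m = 0")
  case True then show ?thesis using assms by simp
next
  case False
  show ?thesis
  proof clarify
    fix y assume y: "y \<in> K"
    have "(l / m) *\<^sub>R y + (1 - l / m) *\<^sub>R 0 \<in> K"
      using assms False by (intro convexD[OF convex_K] y zero_mem_K) (auto simp: divide_le_eq)
    moreover have "l *\<^sub>R y = m *\<^sub>R ((l / m) *\<^sub>R y + (1 - l / m) *\<^sub>R 0)"
      using False by simp
    ultimately show "l *\<^sub>R y \<in> (*\<^sub>R) m ` K" by (metis imageI)
  qed
qed

text \<open>Makes the infimum defining \<open>g\<close> a minimum. For \<open>x \<noteq> 0\<close>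
  boundedness of \<open>K\<close> keeps the scales above \<open>norm x / R\<close>, and away from 0
  they form the preimage of the closed set \<open>K\<close> under a continuous map.\<close>

lemma closed_scales: "closed {l. 0 \<le> l \<and> x \<in> (*\<^sub>R) l ` K}"
proof (cases "x = 0")
  case True
  have "{l. 0 \<le> l \<and> x \<in> (*\<^sub>R) l ` K} = {0..}"
    using zero_mem_K by (auto simp: True image_iff)
  then show ?thesis by simp
next
  case False
  obtain R where R: "0 < R" "\<And>y. y \<in> K \<Longrightarrow> norm y \<le> R"
    using compact_imp_bounded[OF compact_K] bounded_pos by metis
  define r where "r = norm x / R"
  have r: "0 < r" unfolding r_def using R False by simp
  have "{l. 0 \<le> l \<and> x \<in> (*\<^sub>R) l ` K} = {l \<in> {r..}. (1 / l) *\<^sub>R x \<in> K}"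
  proof (intro set_eqI iffI)
    fix l assume "l \<in> {l. 0 \<le> l \<and> x \<in> (*\<^sub>R) l ` K}"
    then obtain y where l: "0 \<le> l" "x = l *\<^sub>R y" "y \<in> K" by auto
    have "norm x \<le> l * R" using l R by (simp add: mult_left_mono)
    then have "r \<le> l" unfolding r_def using R by (simp add: pos_divide_le_eq)
    then show "l \<in> {l \<in> {r..}. (1 / l) *\<^sub>R x \<in> K}" using r l by simp
  next
    fix l assume "l \<in> {l \<in> {r..}. (1 / l) *\<^sub>R x \<in> K}"
    then show "l \<in> {l. 0 \<le> l \<and> x \<in> (*\<^sub>R) l ` K}" using r mem_scale_iff_scaled[of l x] by simp
  qed
  also have "\<dots> = {r..} \<inter> (\<lambda>l. (1 / l) *\<^sub>R x) -` K" by auto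
  finally have eq: "{l. 0 \<le> l \<and> x \<in> (*\<^sub>R) l ` K} = {r..} \<inter> (\<lambda>l. (1 / l) *\<^sub>R x) -` K" .
  have "continuous_on {r..} (\<lambda>l. (1 / l) *\<^sub>R x)" using r by (auto intro!: continuous_intros)
  then show ?thesis
    unfolding eq by (rule continuous_closed_preimage) (auto simp: compact_imp_closed compact_K)
qed

lemma g_mem: "x \<in> (*\<^sub>R) (g x) ` K" and g_nonneg: "0 \<le> g x"
proof -
  have "g x \<in> {l. 0 \<le> l \<and> x \<in> (*\<^sub>R) l ` K}"
    unfolding minkowski_functional_def
  proof (rule closed_contains_Inf[OF _ _ closed_scales])
    show "{l. 0 \<le> l \<and> x \<in> (*\<^sub>R) l ` K} \<noteq> {}" using absorbing[of x] less_imp_le by blast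
    show "bdd_below {l. 0 \<le> l \<and> x \<in> (*\<^sub>R) l ` K}" by (rule bdd_belowI[of _ 0]) auto
  qed
  then show "x \<in> (*\<^sub>R) (g x) ` K" "0 \<le> g x" by auto
qed

text \<open>Turns the scaled bodies in \<open>succ_min\<close> into sublevel sets of
  \<open>g\<close>.\<close>

lemma mem_scale_iff: "0 \<le> l \<Longrightarrow> x \<in> (*\<^sub>R) l ` K \<longleftrightarrow> g x \<le> l"
proof
  assume "0 \<le> l" "x \<in> (*\<^sub>R) l ` K"
  then show "g x \<le> l"
    unfolding minkowski_functional_def by (intro cInf_lower bdd_belowI[of _ 0]) auto
next
  assume "0 \<le> l" "g x \<le> l"
  then show "x \<in> (*\<^sub>R) l ` K" using scale_mono[OF g_nonneg] g_mem by blast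
qed

lemma g_eq_0: "g x = 0 \<Longrightarrow> x = 0"
  using g_mem[of x] by auto

lemma g_scale_le: "0 \<le> c \<Longrightarrow> g (c *\<^sub>R x) \<le> c * g x"
proof -
  assume c: "0 \<le> c"
  obtain y where "y \<in> K" "x = g x *\<^sub>R y" using g_mem[of x] by auto
  then have "c *\<^sub>R x = (c * g x) *\<^sub>R y" "y \<in> K" by (metis scaleR_scaleR)+
  then show ?thesis using c g_nonneg by (subst mem_scale_iff[symmetric]) auto
qed

text \<open>Convexity gives subadditivity, and symmetry allows a difference in place of the sum;
  differences are what congruent lattice points provide.\<close>

lemma g_diff_le: "g (x - y) \<le> g x + g y"
proof (cases "g x + g y = 0")
  case True
  then have "x = 0" "y = 0" using g_nonneg[of x] g_nonneg[of y] g_eq_0 by force+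
  then show ?thesis using g_nonneg[of 0] True by auto
next
  case False
  define a b where "a = g x" and "b = g y"
  have ab: "0 \<le> a" "0 \<le> b" "0 < a + b" using g_nonneg[of x] g_nonneg[of y] False unfolding a_def b_def by auto
  obtain u where u: "u \<in> K" "x = a *\<^sub>R u" using g_mem[of x] a_def by auto
  obtain v where v: "v \<in> K" "y = b *\<^sub>R v" using g_mem[of y] b_def by auto
  have "(a / (a + b)) *\<^sub>R u + (b / (a + b)) *\<^sub>R (- v) \<in> K"
    using ab by (intro convexD[OF convex_K] u v uminus_K) (auto simp: add_divide_distrib[symmetric])
  moreover have "x - y = (a + b) *\<^sub>R ((a / (a + b)) *\<^sub>R u + (b / (a + b)) *\<^sub>R (- v))"
  proof -
    have "(a + b) *\<^sub>R ((a / (a + b)) *\<^sub>R u) = a *\<^sub>R u" "(a + b) *\<^sub>R ((b / (a + b)) *\<^sub>R (- v)) = - (b *\<^sub>R v)"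
      using ab by simp_all
    then show ?thesis using u v by (simp only: scaleR_add_right) simp
  qed
  ultimately have "x - y \<in> (*\<^sub>R) (a + b) ` K" by blast
  then show ?thesis using ab mem_scale_iff[of "a + b" "x - y"] unfolding a_def b_def by simp
qed

section \<open>Successive minima in terms of sublevel sets\<close>

lemma finite_lattice_sublevel:
  assumes "is_lattice L" shows "finite {x \<in> L. g x \<le> l}"
proof (cases "0 \<le> l")
  case True
  have "{x \<in> L. g x \<le> l} = L \<inter> (*\<^sub>R) l ` K" using mem_scale_iff[OF True] by auto
  then show ?thesis
    using finite_lattice_Int_bounded[OF assms] compact_imp_bounded[OF compact_scaling[OF compact_K]] by simp
next
  case False
  then have "{x \<in> L. g x \<le> l} = {}" using g_nonneg order_trans by blast
  then show ?thesis by (metis finite.emptyI)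
qed

lemma finite_lattice_sublevel_strict:
  assumes "is_lattice L" shows "finite {x \<in> L. g x < l}"
  by (rule finite_subset[OF _ finite_lattice_sublevel[OF assms, of l]]) auto

text \<open>Needed because \<open>Least\<close> on the reals says nothing unless the minimum is
  attained. Only finitely many values of \<open>g\<close> on \<open>X\<close> lie below
  \<open>l1\<close>, and the dimension can jump only at such a value, so the minimum is one over a
  finite set. The scale \<open>l1\<close> witnesses that some scale qualifies.\<close>

lemma succ_min_attained:
  assumes L: "is_lattice L" and X: "X \<subseteq> L" and l1: "0 \<le> l1" "j \<le> dim {x \<in> X. g x \<le> l1}"
  shows "j \<le> dim {x \<in> X. g x \<le> succ_min K X j}" "succ_min K X j \<le> l1"
proof -
  define Q where "Q l \<longleftrightarrow> 0 \<le> l \<and> j \<le> dim {x \<in> X. g x \<le> l}" for l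
  have "(*\<^sub>R) l ` K \<inter> X = {x \<in> X. g x \<le> l}" if "0 \<le> l" for l
    using mem_scale_iff[OF that] by blast
  then have sm: "succ_min K X j = (LEAST l. Q l)"
    unfolding succ_min_def Q_def by (intro arg_cong[where f = Least] ext conj_cong refl) simp
  define F where "F = {x \<in> X. g x \<le> l1}"
  have finF: "finite F" unfolding F_def by (rule finite_subset[OF _ finite_lattice_sublevel[OF L, of l1]]) (use X in auto)
  define C where "C = {l \<in> insert 0 (g ` F). Q l}"
  \<comment> \<open>Rounding \<open>l\<close> down to the largest value of \<open>g\<close> not
    exceeding it, or to 0 if there is none, leaves the sublevel set unchanged.\<close>
  have below: "\<exists>m\<in>C. m \<le> l" if "Q l" "l \<le> l1" for l
  proof -
    define D where "D = insert 0 (g ` {x \<in> F. g x \<le> l})"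
    define m where "m = Max D"
    have D: "finite D" "D \<noteq> {}" unfolding D_def using finF by auto
    have mD: "m \<in> D" unfolding m_def using D by simp
    have ml: "m \<le> l" using mD that unfolding D_def Q_def by auto
    have "{x \<in> X. g x \<le> m} = {x \<in> X. g x \<le> l}"
    proof (intro Collect_cong conj_cong refl iffI)
      fix x assume "x \<in> X" "g x \<le> l"
      then have "g x \<in> D" unfolding D_def F_def using that by auto
      then show "g x \<le> m" unfolding m_def using D by simp
    qed (use ml in auto)
    moreover have "0 \<le> m" unfolding m_def using D by (intro Max_ge) (auto simp: D_def)
    ultimately have "Q m" using that unfolding Q_def by simp
    then show ?thesis using ml mD unfolding C_def D_def by auto
  qed
  have Q1: "Q l1" using l1 unfolding Q_def by simp
  have finC: "finite C" unfolding C_def using finF by auto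
  have neC: "C \<noteq> {}" using below[OF Q1] by auto
  have MinC: "Min C \<in> C" using finC neC by simp
  then have QM: "Q (Min C)" unfolding C_def by simp
  have low: "Min C \<le> l" if "Q l" for l
  proof (cases "l \<le> l1")
    case True
    then show ?thesis using below[OF that] finC by (meson Min_le order_trans)
  next
    case False
    then show ?thesis using below[OF Q1] finC by (meson Min_le order_trans linear)
  qed
  have "succ_min K X j = Min C" unfolding sm using QM low by (rule Least_equality)
  then show "j \<le> dim {x \<in> X. g x \<le> succ_min K X j}" "succ_min K X j \<le> l1"
    using QM low[OF Q1] unfolding Q_def by simp_all
qed

text \<open>The source of the strict inequality for the minimum: finitely many points with
  \<open>g x < r\<close> have a largest value, still below \<open>r\<close>. As \<open>j\<close> is
  positive, there is at least one such point.\<close>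

lemma succ_min_less:
  assumes L: "is_lattice L" and X: "X \<subseteq> L" and dim: "Suc 0 \<le> j" "j \<le> dim {x \<in> X. g x < r}"
  shows "succ_min K X j < r"
proof -
  define F where "F = {x \<in> X. g x < r}"
  have finF: "finite F" unfolding F_def by (rule finite_subset[OF _ finite_lattice_sublevel_strict[OF L, of r]]) (use X in auto)
  have neF: "F \<noteq> {}" using dim unfolding F_def by (metis dim_empty not_one_le_zero One_nat_def order_trans)
  define m where "m = Max (g ` F)"
  have "m \<in> g ` F" unfolding m_def using finF neF by simp
  then have m: "0 \<le> m" "m < r" unfolding F_def using g_nonneg by auto
  have "g x \<le> m" if "x \<in> F" for x unfolding m_def using finF that by simp
  then have "F = {x \<in> X. g x \<le> m}" using m unfolding F_def by auto
  then show ?thesis using succ_min_attained(2)[OF L X m(1), of j] dim m unfolding F_def by simp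
qed

text \<open>A set has positive dimension exactly if it contains a non-zero point, so the first
  minimum is the least value of \<open>g\<close> on the non-zero lattice points.\<close>

lemma succ_min_1:
  assumes L: "is_lattice L" and rank: "1 \<le> lattice_rank L"
  shows "0 < succ_min K L 1" "\<And>x. x \<in> L \<Longrightarrow> x \<noteq> 0 \<Longrightarrow> succ_min K L 1 \<le> g x"
    "\<exists>x\<in>L. x \<noteq> 0 \<and> g x \<le> succ_min K L 1"
proof -
  have dim1: "1 \<le> dim {y \<in> L. g y \<le> g x}" if "x \<in> L" "x \<noteq> 0" for x
  proof -
    have "dim {x} \<le> dim {y \<in> L. g y \<le> g x}" using that by (intro dim_subset) auto
    then show ?thesis using that by (simp add: dim_singleton)
  qed
  have "\<not> L \<subseteq> {0}" using rank lattice_rank_eq_dim[OF L] by (metis dim_eq_0 not_one_le_zero)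
  then obtain x0 where x0: "x0 \<in> L" "x0 \<noteq> 0" by blast
  note att = succ_min_attained[OF L order_refl g_nonneg dim1]
  show "succ_min K L 1 \<le> g x" if "x \<in> L" "x \<noteq> 0" for x using att(2)[OF that] .
  have "dim {x \<in> L. g x \<le> succ_min K L 1} \<noteq> 0" using att(1)[OF x0] by linarith
  then show ex: "\<exists>x\<in>L. x \<noteq> 0 \<and> g x \<le> succ_min K L 1" unfolding dim_eq_0 by blast
  show "0 < succ_min K L 1"
    using ex g_nonneg g_eq_0 by (metis less_le_trans less_eq_real_def order_le_less)
qed

end

section \<open>Upper bound for the number of lattice points\<close>

lemma is_lattice_Int_subspace:
  assumes "is_lattice L" "subspace S" shows "is_lattice (L \<inter> S)"
proof -
  have "discrete (L \<inter> S)" using assms(1) unfolding is_lattice_def by (auto intro: discrete_subset)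
  then show ?thesis
    using assms unfolding is_lattice_def by (auto simp: subspace_0 subspace_diff)
qed

lemma lattice_basis_facts:
  assumes "is_lattice L"
  shows "independent (lattice_basis L)" "finite (lattice_basis L)"
    "int_span (lattice_basis L) = L" "card (lattice_basis L) = lattice_rank L"
  using is_lattice_basis_lattice_basis[OF assms] independent_imp_finite
  unfolding is_lattice_basis_def lattice_rank_def by auto

text \<open>The power is the index of \<open>m L\<close> in \<open>L\<close>: reducing the
  coordinates in a lattice basis modulo \<open>m\<close> is injective on \<open>F\<close>.\<close>

lemma card_le_of_incongruent_mod:
  assumes L: "is_lattice L" and m: "0 < m" and "F \<subseteq> L"
    and inc: "\<And>x y z. x \<in> F \<Longrightarrow> y \<in> F \<Longrightarrow> z \<in> L \<Longrightarrow> x - y = real m *\<^sub>R z \<Longrightarrow> x = y"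
  shows "finite F" "card F \<le> m ^ lattice_rank L"
proof -
  define B where "B = lattice_basis L"
  note B = lattice_basis_facts[OF L, folded B_def]
  have "\<exists>c :: 'a \<Rightarrow> int. x = (\<Sum>b\<in>B. of_int (c b) *\<^sub>R b)" if "x \<in> F" for x
    using that assms(3) B(3) unfolding int_span_def by blast
  then obtain c :: "'a \<Rightarrow> 'a \<Rightarrow> int" where c: "\<And>x. x \<in> F \<Longrightarrow> x = (\<Sum>b\<in>B. of_int (c x b) *\<^sub>R b)"
    by metis
  \<comment> \<open>\<open>restrict\<close> makes the values extensional, so that they lie in a
    finite function space whose cardinality is the claimed power.\<close>
  define f where "f x = restrict (\<lambda>b. c x b mod int m) B" for x
  have "inj_on f F"
  proof (rule inj_onI)
    fix x y assume xy: "x \<in> F" "y \<in> F" "f x = f y"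
    define q where "q b = (c x b - c y b) div int m" for b
    have q: "c x b - c y b = int m * q b" if "b \<in> B" for b
    proof -
      have "c x b mod int m = c y b mod int m"
        using fun_cong[OF xy(3), of b] that by (simp add: f_def)
      then have "int m dvd c x b - c y b" by (simp add: mod_eq_dvd_iff)
      then show ?thesis by (simp add: q_def)
    qed
    have "x - y = (\<Sum>b\<in>B. of_int (c x b - c y b) *\<^sub>R b)"
      using c[OF xy(1)] c[OF xy(2)] by (simp add: scaleR_diff_left sum_subtractf)
    also have "\<dots> = (\<Sum>b\<in>B. of_int (int m * q b) *\<^sub>R b)"
      by (intro sum.cong refl) (simp only: q)
    also have "\<dots> = real m *\<^sub>R (\<Sum>b\<in>B. of_int (q b) *\<^sub>R b)"
      by (simp add: scaleR_sum_right)
    finally have "x - y = real m *\<^sub>R (\<Sum>b\<in>B. of_int (q b) *\<^sub>R b)" .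
    moreover have "(\<Sum>b\<in>B. of_int (q b) *\<^sub>R b) \<in> L"
      using B(3) unfolding int_span_def by blast
    ultimately show "x = y" using inc xy by blast
  qed
  moreover have im: "f ` F \<subseteq> B \<rightarrow>\<^sub>E {0..<int m}" using m by (auto simp: f_def)
  moreover have fin: "finite (B \<rightarrow>\<^sub>E {0..<int m})" using B(2) by (intro finite_PiE) auto
  ultimately show "finite F" by (meson finite_imageD finite_subset)
  have "card F = card (f ` F)" using \<open>inj_on f F\<close> by (simp add: card_image)
  also have "\<dots> \<le> card (B \<rightarrow>\<^sub>E {0..<int m})" using im fin by (rule card_mono[rotated])
  also have "\<dots> = m ^ lattice_rank L" using B by (simp add: card_PiE)
  finally show "card F \<le> m ^ lattice_rank L" .
qed

context symmetric_body
begin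

text \<open>The exponent \<open>r\<close> may exceed the rank, since for the lattices to be counted
  only upper bounds on the rank are given.\<close>

lemma card_nonzero_sublevel_less:
  assumes L: "is_lattice L" and r: "lattice_rank L \<le> r" and \<mu>: "0 < \<mu>" and \<rho>: "0 < \<rho>"
    and min: "\<And>x. x \<in> L \<Longrightarrow> x \<noteq> 0 \<Longrightarrow> \<mu> \<le> g x"
  shows "real (card {x \<in> L - {0}. g x < \<rho>}) < (3 * \<rho> / \<mu>) ^ r"
\<comment> \<open>For \<open>\<rho> \<le> \<mu>\<close> there is nothing to count. Otherwise
  \<open>\<rho> / \<mu> > 1\<close>, which both the rounding of \<open>m\<close> and the passage to
  the exponent \<open>r\<close> need.\<close>
proof (cases "\<mu> < \<rho>")
  case False
  then have "{x \<in> L - {0}. g x < \<rho>} = {}" using min by force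
  then show ?thesis using \<mu> \<rho> by (simp only: card.empty) simp
next
  case True
  define F where "F = {x \<in> L. g x < \<rho>}"
  define m where "m = nat \<lceil>2 * \<rho> / \<mu>\<rceil>"
  have m: "2 * \<rho> / \<mu> \<le> real m" "0 < m" unfolding m_def using \<mu> \<rho> by auto
  \<comment> \<open>Rounding up costs less than 1, hence less than another
    \<open>\<rho> / \<mu>\<close>: this turns the factor 2 into 3.\<close>
  have "real m < 2 * \<rho> / \<mu> + 1" unfolding m_def using \<mu> \<rho>
    by (simp add: ceiling_less_iff) linarith
  also have "\<dots> \<le> 3 * \<rho> / \<mu>" using True \<mu> by (simp add: field_simps)
  finally have m3: "real m \<le> 3 * \<rho> / \<mu>" by simp
  have "x = y" if "x \<in> F" "y \<in> F" "z \<in> L" "x - y = real m *\<^sub>R z" for x y z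
  proof -
    have "z = (1 / real m) *\<^sub>R (x - y)" using that m by simp
    then have "g z \<le> (1 / real m) * g (x - y)" using g_scale_le[of "1 / real m" "x - y"] by simp
    also have "\<dots> \<le> (1 / real m) * (g x + g y)" by (intro mult_left_mono g_diff_le) simp
    also have "\<dots> < (1 / real m) * (2 * \<rho>)"
      using that m by (intro mult_strict_left_mono) (auto simp: F_def)
    also have "\<dots> \<le> \<mu>" using m \<mu> by (simp add: field_simps)
    finally have "z = 0" using min[OF that(3)] by force
    then show ?thesis using that by simp
  qed
  then have card: "finite F" "card F \<le> m ^ lattice_rank L"
    using card_le_of_incongruent_mod[OF L m(2), of F] unfolding F_def by auto
  \<comment> \<open>The origin belongs to \<open>F\<close> but is not counted in the claim, which
    makes the bound strict.\<close>
  have "0 \<in> F" unfolding F_def using is_lattice_0[OF L] g_scale_le[of 0 0] \<rho> by simp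
  moreover have "{x \<in> L - {0}. g x < \<rho>} = F - {0}" unfolding F_def by auto
  ultimately have "card {x \<in> L - {0}. g x < \<rho>} < card F"
    using card(1) by (metis card_Diff1_less)
  then have "real (card {x \<in> L - {0}. g x < \<rho>}) < real m ^ lattice_rank L"
    using card(2) by (metis of_nat_less_iff of_nat_power order_less_le_trans)
  also have "\<dots> \<le> (3 * \<rho> / \<mu>) ^ lattice_rank L" using m3 by (intro power_mono) auto
  also have "\<dots> \<le> (3 * \<rho> / \<mu>) ^ r"
    using True \<mu> r by (intro power_increasing) (auto simp: field_simps)
  finally show ?thesis .
qed

end

section \<open>Fundamental cells and the lower bound for the number of lattice points\<close>

lemma representation_sum_scaleR:
  assumes "independent B" "finite B" "b \<in> B"
  shows "representation B (\<Sum>c\<in>B. t c *\<^sub>R c) b = t b"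
proof -
  have "representation B (\<Sum>c\<in>B. t c *\<^sub>R c) b = (\<Sum>c\<in>B. representation B (t c *\<^sub>R c) b)"
    using assms by (subst representation_sum) (auto intro: span_scale span_base)
  also have "\<dots> = (\<Sum>c\<in>B. if c = b then t b else 0)"
    using assms by (intro sum.cong refl) (auto simp: representation_scale representation_basis span_base)
  finally show ?thesis using assms by simp
qed

lemma norm_fundamental_cell_le:
  fixes B :: "'a::real_normed_vector set"
  assumes "x \<in> fundamental_cell B"
  shows "norm x \<le> (\<Sum>b\<in>B. norm b)"
proof -
  obtain t where t: "x = (\<Sum>b\<in>B. t b *\<^sub>R b)" "\<forall>b\<in>B. 0 \<le> t b \<and> t b < (1::real)"
    using assms unfolding fundamental_cell_def by auto
  then show ?thesis
    unfolding t(1) by (intro sum_norm_le) (simp add: mult_left_le_one_le less_imp_le)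
qed

text \<open>Coordinates are linear functionals, so this form gives measurability of the cell and
  disjointness of its lattice translates.\<close>

lemma fundamental_cell_eq:
  assumes "independent B" "finite B" "span B = UNIV"
  shows "fundamental_cell B = {x. \<forall>b\<in>B. 0 \<le> representation B x b \<and> representation B x b < 1}"
proof (intro set_eqI iffI)
  fix x assume "x \<in> fundamental_cell B"
  then obtain t where t: "x = (\<Sum>b\<in>B. t b *\<^sub>R b)" "\<forall>b\<in>B. 0 \<le> t b \<and> t b < (1::real)"
    unfolding fundamental_cell_def by auto
  have "representation B x b = t b" if "b \<in> B" for b
    unfolding t(1) using representation_sum_scaleR[OF assms(1,2) that] .
  then show "x \<in> {x. \<forall>b\<in>B. 0 \<le> representation B x b \<and> representation B x b < 1}"
    using t by simp
next
  fix x assume "x \<in> {x. \<forall>b\<in>B. 0 \<le> representation B x b \<and> representation B x b < 1}"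
  moreover have "x = (\<Sum>b\<in>B. representation B x b *\<^sub>R b)"
    using sum_representation_eq[OF assms(1) _ assms(2) order_refl, of x] assms(3) by simp
  ultimately show "x \<in> fundamental_cell B" unfolding fundamental_cell_def by blast
qed

lemma lmeasurable_fundamental_cell:
  fixes B :: "'a::euclidean_space set"
  assumes "independent B" "span B = UNIV"
  shows "fundamental_cell B \<in> lmeasurable"
proof -
  have fin: "finite B" using assms(1) by (rule independent_imp_finite)
  have "fundamental_cell B \<subseteq> cball 0 (\<Sum>b\<in>B. norm b)"
    using norm_fundamental_cell_le by auto
  then have bdd: "bounded (fundamental_cell B)" using bounded_cball bounded_subset by blast
  have "linear (\<lambda>x. representation B x b)" for b
    using assms by (intro linearI) (auto simp: representation_add representation_scale)
  then have [measurable]: "(\<lambda>x. representation B x b) \<in> borel_measurable borel" for b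
    by (intro borel_measurable_continuous_onI linear_continuous_on) (simp add: linear_conv_bounded_linear)
  have "{x \<in> space borel. \<forall>b\<in>B. 0 \<le> representation B x b \<and> representation B x b < 1} \<in> sets borel"
    using fin by (intro sets.sets_Collect_finite_All) auto
  then have "fundamental_cell B \<in> sets borel"
    unfolding fundamental_cell_eq[OF assms(1) fin assms(2)] by simp
  then show ?thesis using bdd by (intro bounded_set_imp_lmeasurable) auto
qed

text \<open>Cut \<open>M\<close> along the translates of the cell and shift all pieces back into the
  cell. The number of pieces over \<open>y\<close> is the number of lattice points \<open>l\<close>
  with \<open>y + l \<in> M\<close>, and its integral is the volume of \<open>M\<close>. If it never
  exceeded \<open>k\<close>, that volume would be at most \<open>k\<close> times the
  determinant.\<close>

lemma blichfeldt:
  fixes L :: "'a::euclidean_space set"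
  assumes L: "is_lattice L" and full: "lattice_rank L = DIM('a)"
    and M: "M \<in> lmeasurable" "bounded M"
    and k: "real k * lattice_det L < measure lebesgue M"
  shows "\<exists>y. k < card {l \<in> L. y + l \<in> M}"
proof (rule ccontr)
  assume "\<nexists>y. k < card {l \<in> L. y + l \<in> M}"
  then have le: "card {l \<in> L. y + l \<in> M} \<le> k" for y by (simp add: not_less)
  define B where "B = lattice_basis L"
  note B = lattice_basis_facts[OF L, folded B_def]
  have spanB: "span B = UNIV"
    using B full by (metis dim_eq_card_independent dim_eq_full)
  define P where "P = fundamental_cell B"
  have Peq: "P = {x. \<forall>b\<in>B. 0 \<le> representation B x b \<and> representation B x b < 1}"
    unfolding P_def using fundamental_cell_eq[OF B(1,2) spanB] .
  have Pm: "P \<in> lmeasurable"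
    unfolding P_def using lmeasurable_fundamental_cell[OF B(1) spanB] .
  have detP: "lattice_det L = measure lebesgue P"
    unfolding lattice_det_def P_def B_def ..
  have PB: "norm p \<le> (\<Sum>b\<in>B. norm b)" if "p \<in> P" for p
    using that norm_fundamental_cell_le unfolding P_def by blast
  have cover: "\<exists>l\<in>L. x - l \<in> P" for x
  proof -
    define r where "r = representation B x"
    have x: "x = (\<Sum>b\<in>B. r b *\<^sub>R b)"
      unfolding r_def using sum_representation_eq[OF B(1) _ B(2) order_refl, of x] spanB by simp
    define l where "l = (\<Sum>b\<in>B. of_int \<lfloor>r b\<rfloor> *\<^sub>R b)"
    have "l \<in> int_span B"
      unfolding l_def int_span_def by (rule range_eqI[of _ _ "\<lambda>b. \<lfloor>r b\<rfloor>"]) simp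
    then have "l \<in> L" using B(3) by simp
    moreover have "x - l = (\<Sum>b\<in>B. frac (r b) *\<^sub>R b)"
      unfolding l_def by (subst x) (simp add: frac_def scaleR_diff_left sum_subtractf)
    then have "x - l \<in> P"
      unfolding P_def fundamental_cell_def
      by (auto simp: frac_lt_1 intro!: exI[of _ "\<lambda>b. frac (r b)"])
    ultimately show ?thesis by blast
  qed
  have uniq: "l = l'" if l: "l \<in> L" "l' \<in> L" and p: "x - l \<in> P" "x - l' \<in> P" for l l' x
  proof -
    obtain z :: "'a \<Rightarrow> int" where z: "l - l' = (\<Sum>b\<in>B. of_int (z b) *\<^sub>R b)"
      using is_lattice_diff[OF L l] B(3) unfolding int_span_def by blast
    \<comment> \<open>The coordinates of both points lie in the half-open unit interval, so the
      integer \<open>z b\<close> has absolute value below 1.\<close>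
    have "z b = 0" if b: "b \<in> B" for b
    proof -
      have "representation B (x - l') b - representation B (x - l) b = representation B (l - l') b"
        using B(1) spanB by (simp add: representation_diff)
      also have "\<dots> = of_int (z b)"
        unfolding z using representation_sum_scaleR[OF B(1,2) b] .
      finally have "\<bar>of_int (z b)\<bar> < (1::real)" using p b unfolding Peq by force
      then show ?thesis by linarith
    qed
    then show ?thesis using z by simp
  qed
  obtain R where R: "\<And>x. x \<in> M \<Longrightarrow> norm x \<le> R" using M(2) bounded_iff by blast
  \<comment> \<open>Only cells at points of the finite set \<open>G\<close> can meet the bounded set
    \<open>M\<close>, so all sums are finite.\<close>
  define G where "G = L \<inter> cball 0 (R + (\<Sum>b\<in>B. norm b))"
  have finG: "finite G" unfolding G_def using finite_lattice_Int_bounded[OF L bounded_cball] .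
  have inG: "l \<in> G" if "l \<in> L" "x \<in> M" "x - l \<in> P" for x l
    using norm_triangle_ineq4[of x "x - l"] R[OF that(2)] PB[OF that(3)] that(1)
    unfolding G_def by simp
  \<comment> \<open>\<open>W l\<close> is the piece of \<open>M\<close> in the cell at
    \<open>l\<close>, and \<open>V l\<close> is that piece shifted back.\<close>
  define W where "W l = M \<inter> (+) l ` P" for l
  define V where "V l = (+) (- l) ` W l" for l
  have memW: "x \<in> W l \<longleftrightarrow> x \<in> M \<and> x - l \<in> P" for x l
    unfolding W_def by (auto simp: image_iff intro: bexI[of _ "x - l"])
  have memV: "y \<in> V l \<longleftrightarrow> y \<in> P \<and> y + l \<in> M" for y l
    unfolding V_def by (auto simp: image_iff memW intro: bexI[of _ "y + l"])
  have Wm: "W l \<in> lmeasurable" for l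
    unfolding W_def using M(1) measurable_translation[OF Pm] by (rule fmeasurable.Int)
  have Vm: "V l \<in> lmeasurable" for l unfolding V_def using measurable_translation[OF Wm] .
  have Vi: "integrable lebesgue (indicator (V l) :: 'a \<Rightarrow> real)" for l
    using Vm[of l] by (simp only: lmeasurable_iff_integrable)
  have Pi: "integrable lebesgue (indicator P :: 'a \<Rightarrow> real)"
    using Pm by (simp only: lmeasurable_iff_integrable)
  have "M = (\<Union>l\<in>G. W l)"
  proof (intro equalityI subsetI)
    fix x assume x: "x \<in> M"
    obtain l where l: "l \<in> L" "x - l \<in> P" using cover by blast
    then show "x \<in> (\<Union>l\<in>G. W l)" using inG[OF l(1) x l(2)] x by (intro UN_I[of l]) (simp_all add: memW)
  qed (auto simp: memW)
  moreover have "pairwise (\<lambda>i j. disjnt (W i) (W j)) G"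
  proof (intro pairwiseI)
    fix i j assume ij: "i \<in> G" "j \<in> G" "i \<noteq> j"
    then have "i \<in> L" "j \<in> L" unfolding G_def by auto
    then show "disjnt (W i) (W j)"
      using uniq[of i j] ij(3) unfolding disjnt_iff memW by metis
  qed
  ultimately have "measure lebesgue M = (\<Sum>l\<in>G. measure lebesgue (W l))"
    using measure_UNION'[OF finG Wm] by simp
  also have "\<dots> = (\<Sum>l\<in>G. measure lebesgue (V l))"
    by (intro sum.cong refl) (simp only: V_def measure_translation)
  also have "\<dots> = (\<Sum>l\<in>G. integral\<^sup>L lebesgue (indicator (V l)))"
    by (intro sum.cong refl) simp
  also have "\<dots> = integral\<^sup>L lebesgue (\<lambda>y. \<Sum>l\<in>G. indicator (V l) y :: real)"
    by (rule Bochner_Integration.integral_sum[symmetric]) (rule Vi)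
  also have "\<dots> \<le> integral\<^sup>L lebesgue (\<lambda>y. real k * indicator P y)"
  proof (rule integral_mono)
    show "integrable lebesgue (\<lambda>y. \<Sum>l\<in>G. indicator (V l) y :: real)"
      by (intro Bochner_Integration.integrable_sum Vi)
    show "integrable lebesgue (\<lambda>y. real k * indicator P y)"
      by (intro integrable_mult_right Pi)
    fix y
    have "(\<Sum>l\<in>G. indicator (V l) y :: real) = (\<Sum>l\<in>G. of_bool (y \<in> V l))"
      by (intro sum.cong refl) (simp add: indicator_def)
    also have "\<dots> = real (card (G \<inter> {l. y \<in> V l}))"
      by (simp add: finG)
    also have "\<dots> \<le> real k * indicator P y"
    proof (cases "y \<in> P")
      case True
      have "G \<inter> {l. y \<in> V l} = {l \<in> L. y + l \<in> M}"
      proof (intro equalityI subsetI)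
        fix l assume "l \<in> {l \<in> L. y + l \<in> M}"
        then have l: "l \<in> L" "y + l \<in> M" by auto
        have "(y + l) - l \<in> P" using True by simp
        then show "l \<in> G \<inter> {l. y \<in> V l}" using inG[OF l] l True by (simp add: memV)
      qed (simp add: memV G_def)
      then show ?thesis using le[of y] True by simp
    next
      case False
      then have "G \<inter> {l. y \<in> V l} = {}" using memV by blast
      then show ?thesis by simp
    qed
    finally show "(\<Sum>l\<in>G. indicator (V l) y :: real) \<le> real k * indicator P y" .
  qed
  also have "\<dots> = real k * lattice_det L" unfolding detP by simp
  finally show False using k by simp
qed

text \<open>Starting the differences at a point of maximal norm keeps them disjoint from their
  negatives, so that Blichfeldt's \<open>k + 1\<close> points give \<open>2 k\<close> non-zero lattice points.\<close>
lemma van_der_corput: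
  fixes L :: "'a::euclidean_space set"
  assumes L: "is_lattice L" and full: "lattice_rank L = DIM('a)"
    and S: "compact S" "convex S" "\<And>x. x \<in> S \<Longrightarrow> - x \<in> S"
    and k: "real k * (2 ^ DIM('a) * lattice_det L) < measure lebesgue S"
  shows "2 * k \<le> card {x \<in> L - {0}. x \<in> S}"
proof -
  \<comment> \<open>Differences of points of the half-size body lie in \<open>S\<close>, by symmetry
    and convexity; halving accounts for the factor \<open>2 ^ DIM('a)\<close>.\<close>
  define M where "M = (*\<^sub>R) (1 / 2) ` S"
  have bM: "bounded M" unfolding M_def using S(1) by (intro compact_imp_bounded compact_scaling)
  have mM: "M \<in> lmeasurable"
    unfolding M_def using S(1) by (intro lmeasurable_compact compact_scaling)
  have "measure lebesgue M = measure lebesgue S / 2 ^ DIM('a)"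
    unfolding M_def using measure_lebesgue_affine[of "1/2" 0 S] by (simp add: power_divide)
  then have "real k * lattice_det L * 2 ^ DIM('a) < measure lebesgue M * 2 ^ DIM('a)"
    using k by (simp add: mult_ac)
  then have "real k * lattice_det L < measure lebesgue M" by (rule mult_right_less_imp_less) simp
  then obtain y where y: "k < card {l \<in> L. y + l \<in> M}"
    using blichfeldt[OF L full mM bM] by blast
  define Z where "Z = {l \<in> L. y + l \<in> M}"
  \<comment> \<open>An infinite set has cardinality 0, so this gives finiteness as well as
    non-emptiness.\<close>
  have "card Z \<noteq> 0" using y unfolding Z_def by simp
  then have finZ: "finite Z" and neZ: "Z \<noteq> {}" by (meson card.infinite, auto)
  obtain l0 where l0: "l0 \<in> Z" and l0max: "\<And>l. l \<in> Z \<Longrightarrow> norm (y + l) \<le> norm (y + l0)"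
  proof -
    have "Max ((\<lambda>l. norm (y + l)) ` Z) \<in> (\<lambda>l. norm (y + l)) ` Z" using finZ neZ by simp
    then obtain l0 where l0: "l0 \<in> Z" "Max ((\<lambda>l. norm (y + l)) ` Z) = norm (y + l0)"
      by (elim imageE)
    show ?thesis
    proof (rule that[OF l0(1)])
      fix l assume "l \<in> Z"
      then show "norm (y + l) \<le> norm (y + l0)" unfolding l0(2)[symmetric] using finZ by simp
    qed
  qed
  define D where "D = (\<lambda>l. l - l0) ` (Z - {l0})"
  have finD: "finite D" unfolding D_def using finZ by simp
  have cardD: "k \<le> card D"
  proof -
    have "card D = card Z - 1"
      unfolding D_def using l0 finZ by (simp add: card_image inj_on_def)
    then show ?thesis using y unfolding Z_def by simp
  qed
  have mem: "l - l' \<in> L" "l - l' \<in> S" if l: "l \<in> Z" "l' \<in> Z" for l l'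
  proof -
    show "l - l' \<in> L" using l is_lattice_diff[OF L] unfolding Z_def by auto
    obtain s t where "s \<in> S" "t \<in> S" and st: "y + l = (1/2) *\<^sub>R s" "y + l' = (1/2) *\<^sub>R t"
    proof -
      have "y + l \<in> (*\<^sub>R) (1/2) ` S" "y + l' \<in> (*\<^sub>R) (1/2) ` S" using l unfolding Z_def M_def by auto
      then show ?thesis using that by (elim imageE)
    qed
    then have "(1/2) *\<^sub>R s + (1/2) *\<^sub>R (- t) \<in> S" by (intro convexD[OF S(2)] S(3)) auto
    moreover have "l - l' = (y + l) - (y + l')" by simp
    moreover have "(y + l) - (y + l') = (1/2) *\<^sub>R s + (1/2) *\<^sub>R (- t)" unfolding st by simp
    ultimately show "l - l' \<in> S" by (simp only:)
  qed
  have disj: "D \<inter> uminus ` D = {}"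
  proof (rule ccontr)
    assume "D \<inter> uminus ` D \<noteq> {}"
    then obtain l l' where l: "l \<in> Z" "l' \<in> Z" "l \<noteq> l0" and eq: "l - l0 = - (l' - l0)"
      unfolding D_def by blast
    define u v w where "u = y + l" and "v = y + l'" and "w = y + l0"
    have uv: "u + v = 2 *\<^sub>R w" using eq unfolding u_def v_def w_def
      by (simp add: algebra_simps scaleR_2)
    have n: "norm u \<le> norm w" "norm v \<le> norm w"
      using l l0max unfolding u_def v_def w_def by auto
    \<comment> \<open>Here \<open>w\<close> is the midpoint of \<open>u\<close> and
      \<open>v\<close>, neither of which is longer than \<open>w\<close>. The parallelogram law then
      leaves no room for \<open>u - v\<close>.\<close>
    have "(norm (u + v))\<^sup>2 + (norm (u - v))\<^sup>2 = 2 * (norm u)\<^sup>2 + 2 * (norm v)\<^sup>2"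
      by (simp add: power2_norm_eq_inner algebra_simps inner_commute)
    also have "\<dots> \<le> 4 * (norm w)\<^sup>2"
      using power_mono[OF n(1) norm_ge_zero, of 2] power_mono[OF n(2) norm_ge_zero, of 2]
      by linarith
    also have "\<dots> = (norm (u + v))\<^sup>2" unfolding uv by (simp add: power_mult_distrib)
    finally have "u = v" by simp
    then have "w = u" using uv by (simp add: scaleR_2[symmetric])
    then show False using l unfolding u_def w_def by simp
  qed
  have "card (D \<union> uminus ` D) = 2 * card D"
    using disj finD by (subst card_Un_disjoint) (auto simp: card_image)
  moreover have "D \<union> uminus ` D \<subseteq> {x \<in> L - {0}. x \<in> S}"
    unfolding D_def using mem l0 by (auto simp: image_iff)
  moreover have "finite {x \<in> L - {0}. x \<in> S}"
    by (rule finite_subset[OF _ finite_lattice_Int_bounded[OF L compact_imp_bounded[OF S(1)]]]) auto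
  ultimately show ?thesis using cardD card_mono[of "{x \<in> L - {0}. x \<in> S}" "D \<union> uminus ` D"] by linarith
qed

text \<open>With determinant 0, van der Corput's theorem would apply to the unit ball for every
  \<open>k\<close>, although the ball contains only finitely many lattice points.\<close>

lemma lattice_det_pos:
  fixes L :: "'a::euclidean_space set"
  assumes L: "is_lattice L" and full: "lattice_rank L = DIM('a)"
  shows "0 < lattice_det L"
proof (rule ccontr)
  assume "\<not> 0 < lattice_det L"
  then have 0: "lattice_det L = 0" 
    using measure_nonneg[of lebesgue "fundamental_cell (lattice_basis L)"]
    unfolding lattice_det_def by linarith
  let ?N = "card {x \<in> L - {0}. x \<in> cball 0 1}"
  have "0 < measure lebesgue (cball (0::'a) 1)" by (simp add: content_cball_pos)
  then have "2 * (?N + 1) \<le> ?N"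
    using 0 by (intro van_der_corput[OF L full]) auto
  then show False by simp
qed

context symmetric_body
begin

lemma measure_body_pos: "0 < measure lebesgue K"
proof -
  obtain e where e: "0 < e" "ball 0 e \<subseteq> K"
    using symmetric_body_ball[OF body nonempty_interior] by blast
  have "0 < measure lebesgue (ball (0::'a) e)" using e by (simp add: content_ball_pos)
  also have "\<dots> \<le> measure lebesgue K"
    using e compact_K by (intro measure_mono_fmeasurable) (auto simp: lmeasurable_compact)
  finally show ?thesis .
qed

text \<open>Van der Corput's theorem concerns compact bodies, but the count is over
  \<open>g x < \<rho>\<close>. By continuity of the volume a slightly smaller scale
  \<open>\<xi>\<close> still satisfies its strict hypothesis.\<close>

lemma card_nonzero_sublevel_ge:
  assumes L: "is_lattice L" and full: "lattice_rank L = DIM('a)" and \<rho>: "0 < \<rho>"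
  shows "2 * (\<rho> ^ DIM('a) * measure lebesgue K / (2 ^ DIM('a) * lattice_det L)) - 2
    \<le> real (card {x \<in> L - {0}. g x < \<rho>})"
proof -
  define d where "d = 2 ^ DIM('a) * lattice_det L"
  have d: "0 < d" unfolding d_def using lattice_det_pos[OF L full] by simp
  define V where "V \<xi> = \<xi> ^ DIM('a) * measure lebesgue K / d" for \<xi>
  \<comment> \<open>The largest integer strictly below \<open>V \<rho>\<close>. It is at least
    \<open>V \<rho> - 1\<close>, and doubling gives the loss of 2.\<close>
  define k where "k = nat (\<lceil>V \<rho>\<rceil> - 1)"
  have "0 < V \<rho>" unfolding V_def using \<rho> d measure_body_pos by simp
  then have k: "real k < V \<rho>" "V \<rho> - 1 \<le> real k" unfolding k_def by linarith+
  have "(V \<longlongrightarrow> V \<rho>) (at_left \<rho>)"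
    unfolding V_def using d by (intro tendsto_intros) auto
  then have "\<forall>\<^sub>F \<xi> in at_left \<rho>. real k < V \<xi>" using k(1) by (rule order_tendstoD)
  moreover have "\<forall>\<^sub>F \<xi> in at_left \<rho>. 0 < \<xi> \<and> \<xi> < \<rho>"
    using eventually_at_left_real[OF \<rho>] by (rule eventually_mono) auto
  ultimately have "\<forall>\<^sub>F \<xi> in at_left \<rho>. real k < V \<xi> \<and> 0 < \<xi> \<and> \<xi> < \<rho>"
    by (rule eventually_conj)
  then obtain \<xi> where \<xi>: "real k < V \<xi>" "0 < \<xi>" "\<xi> < \<rho>"
    using eventually_happens[of _ "at_left \<rho>"] by (auto simp: trivial_limit_at_left_real)
  define S where "S = (*\<^sub>R) \<xi> ` K"
  have cS: "compact S" unfolding S_def using compact_K by (rule compact_scaling)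
  have "measure lebesgue S = \<xi> ^ DIM('a) * measure lebesgue K"
    unfolding S_def using measure_lebesgue_affine[of \<xi> 0 K] \<xi> by simp
  then have "real k * d < measure lebesgue S"
    using \<xi> d unfolding V_def by (simp add: field_simps)
  moreover have "- x \<in> S" if "x \<in> S" for x
    using that uminus_K unfolding S_def by (auto simp: image_iff simp flip: scaleR_minus_right)
  moreover have "convex S" unfolding S_def using convex_K by (rule convex_scaling)
  ultimately have "2 * k \<le> card {x \<in> L - {0}. x \<in> S}"
    using cS unfolding d_def
    by (intro van_der_corput[OF L full]) auto
  also have "\<dots> \<le> card {x \<in> L - {0}. g x < \<rho>}"
  proof (rule card_mono)
    show "finite {x \<in> L - {0}. g x < \<rho>}"
      by (rule finite_subset[OF _ finite_lattice_sublevel_strict[OF L, of \<rho>]]) auto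
    show "{x \<in> L - {0}. x \<in> S} \<subseteq> {x \<in> L - {0}. g x < \<rho>}"
      using mem_scale_iff[of \<xi>] \<xi> unfolding S_def by auto
  qed
  finally show ?thesis using k(2) unfolding V_def d_def by linarith
qed

end

section \<open>The inequality satisfied by the right-hand side\<close>

text \<open>Write \<open>\<rho> = A + \<eta>\<close>, so that
  \<open>\<eta> ^ (n - j) = B + E\<close> with \<open>E = C powr ((n - j) / n)\<close>. As
  \<open>\<rho>\<close> is at least the \<open>n\<close>-th root of \<open>C\<close>, the constant
  \<open>C\<close> is absorbed into \<open>E * \<rho> ^ j\<close>. Then
  \<open>(B + E) * \<rho> ^ j\<close> is at most \<open>\<eta> * \<rho> ^ (n - 1)\<close>, which
  together with the \<open>A\<close> term makes \<open>\<rho> ^ n\<close>.\<close>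

lemma bound_exceeds_root:
  fixes A B C \<rho> :: real
  assumes n: "1 \<le> j" "j < n" and pos: "0 \<le> A" "0 \<le> B" "0 < C"
    and \<rho>: "\<rho> = A + (B + C powr (real (n - j) / real n)) powr (1 / real (n - j))"
  shows "0 < \<rho>" "A * \<rho> ^ (n - 1) + B * \<rho> ^ j + C \<le> \<rho> ^ n"
proof -
  define E where "E = C powr (real (n - j) / real n)"
  define \<eta> where "\<eta> = (B + E) powr (1 / real (n - j))"
  have E: "0 < E" unfolding E_def using pos by simp
  have \<eta>: "0 < \<eta>" unfolding \<eta>_def using E pos by simp
  have \<rho>': "\<rho> = A + \<eta>" unfolding \<rho> \<eta>_def E_def ..
  then show \<rho>0: "0 < \<rho>" using \<eta> pos by simp
  have \<eta>_pow: "\<eta> ^ (n - j) = B + E"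
    unfolding \<eta>_def using E pos n by (subst powr_realpow[symmetric]) (auto simp: powr_powr)
  have "C powr (1 / real n) = E powr (1 / real (n - j))"
    unfolding E_def using n by (simp add: powr_powr)
  also have "\<dots> \<le> \<eta>" unfolding \<eta>_def using E pos by (intro powr_mono2) auto
  also have "\<dots> \<le> \<rho>" using \<rho>' pos by simp
  finally have "(C powr (1 / real n)) powr real j \<le> \<rho> powr real j" by (intro powr_mono2) auto
  then have Cj: "C powr (real j / real n) \<le> \<rho> ^ j" using \<rho>0 by (simp add: powr_powr powr_realpow)
  have "C = E * C powr (real j / real n)"
  proof -
    have "real (n - j) / real n + real j / real n = 1" using n by (simp add: field_simps)
    then show ?thesis unfolding E_def using pos by (simp flip: powr_add)
  qed
  also have "\<dots> \<le> E * \<rho> ^ j" using E Cj by simp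
  finally have "A * \<rho> ^ (n - 1) + B * \<rho> ^ j + C \<le> A * \<rho> ^ (n - 1) + (B + E) * \<rho> ^ j"
    by (simp add: algebra_simps)
  also have "(B + E) * \<rho> ^ j = \<eta> * \<eta> ^ (n - 1 - j) * \<rho> ^ j"
    unfolding \<eta>_pow[symmetric] using n by (simp flip: power_Suc add: Suc_diff_Suc)
  \<comment> \<open>Of the \<open>n - j\<close> factors \<open>\<eta>\<close> one is kept to be
    added to \<open>A\<close>; the others are enlarged to \<open>\<rho>\<close>.\<close>
  also have "\<dots> \<le> \<eta> * \<rho> ^ (n - 1 - j) * \<rho> ^ j"
    using \<eta> \<rho>' pos \<rho>0 by (intro mult_right_mono mult_left_mono power_mono) auto
  also have "\<dots> = \<eta> * \<rho> ^ (n - 1)" using n by (simp add: mult.assoc flip: power_add)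
  also have "A * \<rho> ^ (n - 1) + \<eta> * \<rho> ^ (n - 1) = \<rho> * \<rho> ^ (n - 1)"
    unfolding \<rho>' by (simp add: algebra_simps)
  also have "\<dots> = \<rho> ^ n" using n by (simp flip: power_Suc)
  finally show "A * \<rho> ^ (n - 1) + B * \<rho> ^ j + C \<le> \<rho> ^ n" by simp
qed

section \<open>Contradiction between the two counts\<close>

theorem corollary2p1:
  fixes K :: "(real ^ 'n) set"
    and L :: "(real ^ 'n) set"
    and Ls :: "nat \<Rightarrow> (real ^ 'n) set"
    and n s j :: nat
  assumes "n = CARD('n)" and "n \<ge> 2"
    and "o_symmetric_convex_body K" and "interior K \<noteq> {}"
    and "is_lattice L" and "lattice_rank L = n"
    and "s \<ge> 1"
    and "\<And>i. i \<in> {1..s} \<Longrightarrow>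
           is_lattice (Ls i) \<and> Ls i \<subseteq> L \<and> 1 \<le> lattice_rank (Ls i) \<and> lattice_rank (Ls i) \<le> n - 1"
    and "j \<in> {1..n - 1}"
  shows "succ_min K (L - (\<Union>i\<in>{1..s}. Ls i)) (j + 1)
    < 6 ^ (n - 1) * (lattice_det L / (succ_min K L 1 ^ (n - 2) * measure lebesgue K))
          * (\<Sum>i = 1..s. 1 / succ_min K (Ls i) 1)
      + (3 ^ j / succ_min K L 1 ^ j * 2 ^ (n - 1) * (lattice_det L / measure lebesgue K)
          + (2 ^ n * (lattice_det L / measure lebesgue K)) powr (real (n - j) / real n))
        powr (1 / real (n - j))"
proof -
  interpret symmetric_body K by unfold_locales (fact assms)+
  note n = assms(1,2) and L = assms(5) and j = assms(9)
  have full: "lattice_rank L = DIM(real ^ 'n)" using assms by simp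
  define X where "X = L - (\<Union>i\<in>{1..s}. Ls i)"
  define v d \<kappa> where "v = measure lebesgue K" and "d = lattice_det L" and "\<kappa> = succ_min K L 1"
  define \<mu> where "\<mu> i = succ_min K (Ls i) 1" for i
  define \<sigma> where "\<sigma> = (\<Sum>i = 1..s. 1 / \<mu> i)"
  define A B C where "A = 6 ^ (n - 1) * (d / (\<kappa> ^ (n - 2) * v)) * \<sigma>"
    and "B = 3 ^ j / \<kappa> ^ j * 2 ^ (n - 1) * (d / v)" and "C = 2 ^ n * (d / v)"
  define \<rho> where "\<rho> = A + (B + C powr (real (n - j) / real n)) powr (1 / real (n - j))"
  have Ls: "is_lattice (Ls i)" "Ls i \<subseteq> L" "1 \<le> lattice_rank (Ls i)" "lattice_rank (Ls i) \<le> n - 1"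
    if "i \<in> {1..s}" for i using assms(8)[OF that] by auto
  have v: "0 < v" unfolding v_def by (rule measure_body_pos)
  have d: "0 < d" unfolding d_def using lattice_det_pos[OF L full] .
  have "1 \<le> lattice_rank L" using assms by simp
  note \<kappa> = succ_min_1(1,2)[OF L this, folded \<kappa>_def]
  have \<mu>: "0 < \<mu> i" "\<And>x. x \<in> Ls i \<Longrightarrow> x \<noteq> 0 \<Longrightarrow> \<mu> i \<le> g x" "\<kappa> \<le> \<mu> i" if i: "i \<in> {1..s}" for i
  proof -
    note m = succ_min_1[OF Ls(1,3)[OF i], folded \<mu>_def]
    show "0 < \<mu> i" "\<And>x. x \<in> Ls i \<Longrightarrow> x \<noteq> 0 \<Longrightarrow> \<mu> i \<le> g x" by (fact m)+
    show "\<kappa> \<le> \<mu> i" using m(3) \<kappa>(2) Ls(2)[OF i] by force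
  qed
  have "0 \<le> \<sigma>" unfolding \<sigma>_def using \<mu>(1) by (intro sum_nonneg) (simp add: less_imp_le)
  then have "0 \<le> A" "0 \<le> B" "0 < C" unfolding A_def B_def C_def using v d \<kappa>(1) by simp_all
  then have \<rho>: "0 < \<rho>" and root: "A * \<rho> ^ (n - 1) + B * \<rho> ^ j + C \<le> \<rho> ^ n"
    using bound_exceeds_root[of j n A B C \<rho>] j n \<rho>_def by auto
  define P where "P = {x \<in> X. g x < \<rho>}"
  have "j + 1 \<le> dim P"
  proof (rule ccontr)
    assume "\<not> j + 1 \<le> dim P"
    then have dimP: "dim P \<le> j" by simp
    \<comment> \<open>A lattice of rank at most \<open>j\<close> that contains every point of
      \<open>P\<close>; as a subset of \<open>L\<close> it inherits the lower bound
      \<open>\<kappa>\<close> for its non-zero points.\<close>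
    define S where "S = L \<inter> span P"
    have S: "is_lattice S" unfolding S_def using L subspace_span by (rule is_lattice_Int_subspace)
    have "dim S \<le> dim (span P)" unfolding S_def by (intro dim_subset) auto
    then have rankS: "lattice_rank S \<le> j" using lattice_rank_eq_dim[OF S] dimP by simp
    define N where "N Y = {x \<in> Y - {0}. g x < \<rho>}" for Y
    have finN: "finite (N Y)" if "is_lattice Y" for Y
      unfolding N_def by (rule finite_subset[OF _ finite_lattice_sublevel_strict[OF that, of \<rho>]]) auto
    have "N L \<subseteq> (\<Union>i\<in>{1..s}. N (Ls i)) \<union> N S"
    proof
      fix x assume x: "x \<in> N L"
      show "x \<in> (\<Union>i\<in>{1..s}. N (Ls i)) \<union> N S"
      proof (cases "x \<in> X")
        case True
        then have "x \<in> span P" using x unfolding P_def N_def by (intro span_base) auto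
        then show ?thesis using x unfolding N_def S_def by auto
      next
        case False
        then show ?thesis using x unfolding N_def X_def by auto
      qed
    qed
    then have "card (N L) \<le> card ((\<Union>i\<in>{1..s}. N (Ls i)) \<union> N S)"
      using finN Ls(1) S by (intro card_mono) auto
    also have "\<dots> \<le> card (\<Union>i\<in>{1..s}. N (Ls i)) + card (N S)" by (rule card_Un_le)
    also have "\<dots> \<le> (\<Sum>i = 1..s. card (N (Ls i))) + card (N S)"
      by (intro add_right_mono card_UN_le) auto
    finally have "real (card (N L)) \<le> (\<Sum>i = 1..s. real (card (N (Ls i)))) + real (card (N S))"
      by (metis of_nat_add of_nat_le_iff of_nat_sum)
    \<comment> \<open>This count supplies the strictness of the final inequality; non-strict bounds
      suffice for the others.\<close>
    moreover have "real (card (N S)) < (3 * \<rho> / \<kappa>) ^ j"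
      unfolding N_def using \<kappa>(2) by (intro card_nonzero_sublevel_less S rankS \<kappa>(1) \<rho>) (simp add: S_def)
    moreover have "real (card (N (Ls i))) \<le> (3 * \<rho>) ^ (n - 1) / \<kappa> ^ (n - 2) * (1 / \<mu> i)"
      if i: "i \<in> {1..s}" for i
    proof -
      have "real (card (N (Ls i))) \<le> (3 * \<rho> / \<mu> i) ^ (n - 1)"
        unfolding N_def using Ls[OF i] \<mu>[OF i] \<rho> by (intro card_nonzero_sublevel_less[THEN less_imp_le]) auto
      also have "\<dots> = (3 * \<rho>) ^ (n - 1) / (\<mu> i ^ (n - 2) * \<mu> i)"
        using n by (simp add: power_divide flip: power_Suc2 Suc_diff_le)
      \<comment> \<open>All but one of the \<open>n - 1\<close> factors \<open>\<mu> i\<close> are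
        replaced by the smaller \<open>\<kappa>\<close>; the remaining one produces the sum of
        reciprocals.\<close>
      also have "\<dots> \<le> (3 * \<rho>) ^ (n - 1) / (\<kappa> ^ (n - 2) * \<mu> i)"
        using \<rho> \<kappa>(1) \<mu>[OF i] by (intro divide_left_mono mult_right_mono power_mono mult_pos_pos) auto
      finally show ?thesis by simp
    qed
    then have "(\<Sum>i = 1..s. real (card (N (Ls i)))) \<le> (3 * \<rho>) ^ (n - 1) / \<kappa> ^ (n - 2) * \<sigma>"
      unfolding \<sigma>_def sum_distrib_left by (rule sum_mono)
    moreover have "2 * (\<rho> ^ n * v / (2 ^ n * d)) - 2 \<le> real (card (N L))"
      using card_nonzero_sublevel_ge[OF L full \<rho>] n unfolding N_def v_def d_def by simp
    ultimately have "2 * (\<rho> ^ n * v / (2 ^ n * d)) - 2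
        < (3 * \<rho>) ^ (n - 1) / \<kappa> ^ (n - 2) * \<sigma> + (3 * \<rho> / \<kappa>) ^ j" by linarith
    \<comment> \<open>The factor normalises the coefficient of \<open>\<rho> ^ n\<close> to 1 and
      turns the loss of 2 into \<open>C\<close>. On the right
      \<open>3 ^ (n - 1) * 2 ^ (n - 1)\<close> becomes the \<open>6 ^ (n - 1)\<close> in
      \<open>A\<close>.\<close>
    then have "(2 * (\<rho> ^ n * v / (2 ^ n * d)) - 2) * (2 ^ (n - 1) * d / v)
        < ((3 * \<rho>) ^ (n - 1) / \<kappa> ^ (n - 2) * \<sigma> + (3 * \<rho> / \<kappa>) ^ j) * (2 ^ (n - 1) * d / v)"
      using v d by (intro mult_strict_right_mono) auto
    moreover have "(2 * (\<rho> ^ n * v / (2 ^ n * d)) - 2) * (2 ^ (n - 1) * d / v) = \<rho> ^ n - C"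
    proof -
      have "2 ^ n = 2 * (2::real) ^ (n - 1)" using n by (simp flip: power_Suc)
      then show ?thesis unfolding C_def using v d by (simp add: field_simps)
    qed
    moreover have "((3 * \<rho>) ^ (n - 1) / \<kappa> ^ (n - 2) * \<sigma> + (3 * \<rho> / \<kappa>) ^ j) * (2 ^ (n - 1) * d / v)
        = A * \<rho> ^ (n - 1) + B * \<rho> ^ j"
    proof -
      have "6 ^ (n - 1) = 2 ^ (n - 1) * (3::real) ^ (n - 1)" by (simp flip: power_mult_distrib)
      then show ?thesis
        unfolding A_def B_def using v d \<kappa>(1) by (simp add: power_mult_distrib power_divide field_simps)
    qed
    ultimately show False using root by linarith
  qed
  then have "succ_min K X (j + 1) < \<rho>"
    unfolding P_def by (intro succ_min_less[OF L]) (auto simp: X_def)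
  then show ?thesis
    unfolding X_def \<rho>_def A_def B_def C_def \<sigma>_def \<mu>_def \<kappa>_def d_def v_def .
qed

end
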